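(* Let $s_{21},s_{32},s_{31}\in\mathbb{T}=\mathbb{R}\cup\{-\infty\}$ and let $$P=X^{\odot 2}\oplus Y^{\odot 2}\oplus Z^{\odot 2}\oplus s_{21}\odot X\odot Y\oplus s_{32}\odot Y\odot Z\oplus s_{31}\odot X\odot Z .$$ Then the following hold. 1. If $-\infty\le s_{ij}<0$ for some $i\neq j$, then $P$ is irreducible. 2. If $s_{ij}\ge 0$ for all $i\neq j$, then $P$ is reducible if and only if the maximum of $s_{21},s_{32},s_{31}$ equals the sum of the other two.
   Context: $\mathbb{T}=\mathbb{R}\cup\{-\infty\}$ is the tropical semifield, with $a\oplus b=\max\{a,b\}$ and $a\odot b=a+b$; the neutral elements are $-\infty$ for $\oplus$ and $0$ for $\odot$. A tropical polynomial in $X,Y,Z$ is a formal polynomial with coefficients in $\mathbb{T}$ (a monomial with coefficient $-\infty$ is absent; a monomial written without coefficient has coefficient $0$); products of polynomials are computed formally, coefficient by coefficient, using $\oplus$ and $\odot$. We put $s_{ij}=s_{ji}$. A tropical polynomial is reducible if it is the tropical product of two non-constant tropical polynomials, and irreducible otherwise. *)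

theory Defs
  imports Complex_Main "HOL-Library.Poly_Mapping"
begin

section \<open>The tropical semifield\<close>

datatype trop = MInf | Fin real

text \<open>The order is the usual one on \<open>\<real> \<union> {-\<infinity>}\<close>, with \<open>MInf\<close> the least element.\<close>

instantiation trop :: linorder
begin

fun less_eq_trop :: "trop \<Rightarrow> trop \<Rightarrow> bool" where
  "MInf \<le> b \<longleftrightarrow> True"
| "Fin x \<le> MInf \<longleftrightarrow> False"
| "Fin x \<le> Fin y \<longleftrightarrow> x \<le> y"

definition less_trop :: "trop \<Rightarrow> trop \<Rightarrow> bool" where
  "a < b \<longleftrightarrow> a \<le> b \<and> \<not> b \<le> (a :: trop)"

instance
proof
  fix a b c :: trop
  show "a < b \<longleftrightarrow> a \<le> b \<and> \<not> b \<le> a"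
    by (fact less_trop_def)
  show "a \<le> a"
    by (cases a) auto
  show "a \<le> c" if "a \<le> b" "b \<le> c"
    using that by (cases a; cases b; cases c) auto
  show "a = b" if "a \<le> b" "b \<le> a"
    using that by (cases a; cases b) auto
  show "a \<le> b \<or> b \<le> a"
    by (cases a; cases b) auto
qed

end

text \<open>
  The semiring operations of type \<open>trop\<close> are the tropical ones: \<open>+\<close> is \<open>\<oplus>\<close> (maximum) and \<open>*\<close> is
  \<open>\<odot>\<close> (ordinary addition).  Hence the class constant \<open>0\<close> denotes \<open>-\<infinity>\<close>, the class constant
  \<open>1\<close> denotes the real number zero, and the latter is written \<open>Fin 0\<close> where its order matters.
\<close>

instantiation trop :: comm_semiring_1
begin

definition zero_trop :: trop where "0 = MInf"

definition one_trop :: trop where "1 = Fin 0"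

definition plus_trop :: "trop \<Rightarrow> trop \<Rightarrow> trop" where "a + b = max a (b :: trop)"

fun times_trop :: "trop \<Rightarrow> trop \<Rightarrow> trop" where
  "MInf * b = MInf"
| "Fin x * MInf = MInf"
| "Fin x * Fin y = Fin (x + y)"

instance
proof
  fix a b c :: trop
  show "a * b * c = a * (b * c)"
    by (cases a; cases b; cases c) auto
  show "a * b = b * a"
    by (cases a; cases b) auto
  show "1 * a = a"
    by (cases a) (auto simp: one_trop_def)
  show "a + b + c = a + (b + c)"
    by (simp add: plus_trop_def max.assoc)
  show "a + b = b + a"
    by (simp add: plus_trop_def max.commute)
  show "0 + a = a"
    by (cases a) (auto simp: zero_trop_def plus_trop_def max_def)
  show "(a + b) * c = a * c + b * c"
    by (cases a; cases b; cases c) (auto simp: plus_trop_def max_def)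
  show "0 * a = 0"
    by (simp add: zero_trop_def)
  show "a * 0 = 0"
    by (cases a) (auto simp: zero_trop_def)
  show "(0 :: trop) \<noteq> 1"
    by (simp add: zero_trop_def one_trop_def)
qed

end

section \<open>Formal tropical polynomials in three variables\<close>

datatype var = VX | VY | VZ

text \<open>
  A polynomial is a finitely supported map from exponent vectors to coefficients, where absent
  monomials have coefficient \<open>0 = -\<infinity>\<close>; its product is the library's convolution product, computed
  coefficientwise with \<open>\<oplus>\<close> and \<open>\<odot>\<close>.  Polynomials are thus not identified with the functions they
  induce.
\<close>

type_synonym trop_poly = "(var \<Rightarrow>\<^sub>0 nat) \<Rightarrow>\<^sub>0 trop"

definition Const :: "trop \<Rightarrow> trop_poly" where
  "Const c = Poly_Mapping.single 0 c"

definition Var :: "var \<Rightarrow> trop_poly" where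
  "Var v = Poly_Mapping.single (Poly_Mapping.single v 1) 1"

definition constant_poly :: "trop_poly \<Rightarrow> bool" where
  "constant_poly Q \<longleftrightarrow> (\<exists>c. Q = Const c)"

definition trop_reducible :: "trop_poly \<Rightarrow> bool" where
  "trop_reducible Q \<longleftrightarrow> (\<exists>F G. \<not> constant_poly F \<and> \<not> constant_poly G \<and> Q = F * G)"

definition trop_irreducible :: "trop_poly \<Rightarrow> bool" where
  "trop_irreducible Q \<longleftrightarrow> \<not> trop_reducible Q"

text \<open>
  The largest of three elements equals the ordinary sum of the other two; the sum is written
  \<open>*\<close> because it is the tropical product.
\<close>

definition max_eq_sum_of_others :: "trop \<Rightarrow> trop \<Rightarrow> trop \<Rightarrow> bool" where
  "max_eq_sum_of_others a b c \<longleftrightarrow>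
     (a = Max {a, b, c} \<and> a = b * c) \<or>
     (b = Max {a, b, c} \<and> b = a * c) \<or>
     (c = Max {a, b, c} \<and> c = a * b)"

end

theory Submission
  imports Defs
begin

text \<open>
  Since \<open>\<oplus>\<close> never cancels and \<open>\<odot>\<close> has no zero divisors, the support of a product is the sumset of
  the supports. As \<open>P\<close> is homogeneous of degree 2, two non-constant factors must therefore both be
  linear forms, and comparing the coefficients of the squares shows that they are
  \<open>a X \<oplus> b Y \<oplus> c Z\<close> and \<open>(-a) X \<oplus> (-b) Y \<oplus> (-c) Z\<close> with \<open>a, b, c\<close> real. The mixed coefficients of
  their product are \<open>|a - b|\<close>, \<open>|b - c|\<close>, \<open>|a - c|\<close>, and these are precisely the triples of
  nonnegative reals whose maximum is the sum of the other two.
\<close>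

abbreviation "lookup \<equiv> Poly_Mapping.lookup"
abbreviation "keys \<equiv> Poly_Mapping.keys"

section \<open>Arithmetic in the tropical semifield\<close>

lemma trop_add_self: "a + a = (a :: trop)"
  by (simp add: plus_trop_def)

lemma trop_add_eq_0_iff: "a + b = 0 \<longleftrightarrow> a = 0 \<and> b = (0 :: trop)"
  by (cases a; cases b) (auto simp: plus_trop_def zero_trop_def max_def)

lemma trop_mult_eq_0_iff: "a * b = 0 \<longleftrightarrow> a = 0 \<or> b = (0 :: trop)"
  by (cases a; cases b) (auto simp: zero_trop_def)

text \<open>\<open>1\<close> is the real number zero, and a factor \<open>MInf\<close> would force
  the product to be \<open>MInf\<close>.\<close>

lemma trop_mult_eq_1E:
  assumes "a * b = (1 :: trop)"
  obtains r where "a = Fin r" "b = Fin (- r)"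
  using assms by (cases a; cases b) (auto simp: one_trop_def eq_neg_iff_add_eq_0 add.commute)

lemma Fin_add: "Fin x + Fin y = Fin (max x y)"
  by (auto simp: plus_trop_def max_def)

lemma max_diff_eq_abs: "max (x - y) (y - x) = \<bar>x - y :: real\<bar>"
  by (auto simp: max_def)

section \<open>Supports of products\<close>

text \<open>Tropical addition is idempotent, so a term of \<open>F\<close> may be repeated. This
  takes the place of splitting off a term by subtraction.\<close>

lemma trop_poly_add_single_lookup:
  fixes F :: trop_poly
  shows "F + Poly_Mapping.single k (lookup F k) = F"
  by (rule poly_mapping_eqI) (simp add: lookup_add lookup_single when_def trop_add_self)

lemma keys_trop_poly_mult:
  fixes F G :: trop_poly
  assumes "k \<in> keys F" "l \<in> keys G"
  shows "k + l \<in> keys (F * G)"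
proof -
  let ?f = "Poly_Mapping.single k (lookup F k)" and ?g = "Poly_Mapping.single l (lookup G l)"
  \<comment> \<open>Repeating one term in each factor makes the product of these two terms a
    separate summand of the expansion.\<close>
  have "F * G = (F + ?f) * (G + ?g)"
    by (simp add: trop_poly_add_single_lookup)
  also have "\<dots> = (F * G + F * ?g + ?f * G)
      + Poly_Mapping.single (k + l) (lookup F k * lookup G l)"
    by (simp add: algebra_simps mult_single)
  finally have "lookup (F * G) (k + l) =
      lookup (F * G + F * ?g + ?f * G) (k + l) + lookup F k * lookup G l"
    by (metis lookup_add lookup_single_eq)
  with assms show ?thesis
    by (metis in_keys_iff trop_add_eq_0_iff trop_mult_eq_0_iff)
qed

section \<open>Exponents and their total degree\<close>

definition mdeg :: "(var \<Rightarrow>\<^sub>0 nat) \<Rightarrow> nat" where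
  "mdeg m = lookup m VX + lookup m VY + lookup m VZ"

lemma mdeg_add: "mdeg (m + n) = mdeg m + mdeg n"
  by (simp add: mdeg_def lookup_add)

lemma var_monomial_eqI:
  fixes m n :: "var \<Rightarrow>\<^sub>0 nat"
  assumes "lookup m VX = lookup n VX" "lookup m VY = lookup n VY" "lookup m VZ = lookup n VZ"
  shows "m = n"
proof (rule poly_mapping_eqI)
  fix v show "lookup m v = lookup n v"
    using assms by (cases v) auto
qed

lemma mdeg_eq_0_iff: "mdeg m = 0 \<longleftrightarrow> m = 0"
  by (auto simp: mdeg_def intro: var_monomial_eqI)

lemma mdeg_eq_1D:
  assumes "mdeg m = 1"
  shows "m \<in> {Poly_Mapping.single VX 1, Poly_Mapping.single VY 1, Poly_Mapping.single VZ 1}"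
proof -
  consider "lookup m VX = 1" "lookup m VY = 0" "lookup m VZ = 0"
    | "lookup m VX = 0" "lookup m VY = 1" "lookup m VZ = 0"
    | "lookup m VX = 0" "lookup m VY = 0" "lookup m VZ = 1"
    using assms unfolding mdeg_def by linarith
  then show ?thesis
    by cases (auto intro!: var_monomial_eqI simp: lookup_single)
qed

section \<open>Linear and quadratic forms\<close>

definition linear_form :: "trop \<Rightarrow> trop \<Rightarrow> trop \<Rightarrow> trop_poly" where
  "linear_form a b c = Poly_Mapping.single (Poly_Mapping.single VX 1) a
     + Poly_Mapping.single (Poly_Mapping.single VY 1) b
     + Poly_Mapping.single (Poly_Mapping.single VZ 1) c"

text \<open>Exponents stay sums of two unit vectors, the shape that \<open>mult_single\<close>
  produces. The mixed coefficients come in the order of \<open>s21\<close>, \<open>s32\<close>,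
  \<open>s31\<close>.\<close>

definition quadratic_form ::
    "trop \<Rightarrow> trop \<Rightarrow> trop \<Rightarrow> trop \<Rightarrow> trop \<Rightarrow> trop \<Rightarrow> trop_poly" where
  "quadratic_form p q r u v w =
     Poly_Mapping.single (Poly_Mapping.single VX 1 + Poly_Mapping.single VX 1) p
     + Poly_Mapping.single (Poly_Mapping.single VY 1 + Poly_Mapping.single VY 1) q
     + Poly_Mapping.single (Poly_Mapping.single VZ 1 + Poly_Mapping.single VZ 1) r
     + Poly_Mapping.single (Poly_Mapping.single VX 1 + Poly_Mapping.single VY 1) u
     + Poly_Mapping.single (Poly_Mapping.single VY 1 + Poly_Mapping.single VZ 1) v
     + Poly_Mapping.single (Poly_Mapping.single VX 1 + Poly_Mapping.single VZ 1) w"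

text \<open>On the right \<open>single_add\<close> splits each mixed coefficient into two terms, so
  both sides are the same nine terms up to order.\<close>

lemma linear_form_mult:
  "linear_form a b c * linear_form a' b' c' =
     quadratic_form (a * a') (b * b') (c * c') (a * b' + b * a') (b * c' + c * b') (a * c' + c * a')"
  unfolding linear_form_def quadratic_form_def
  by (simp add: distrib_left distrib_right mult_single single_add add_ac)

lemma var_monomial_eq_iff:
  fixes m n :: "var \<Rightarrow>\<^sub>0 nat"
  shows "m = n \<longleftrightarrow>
    lookup m VX = lookup n VX \<and> lookup m VY = lookup n VY \<and> lookup m VZ = lookup n VZ"
  by (auto intro: var_monomial_eqI)

lemma lookup_quadratic_form:
  "lookup (quadratic_form p q r u v w) m =
     (if lookup m VX = 2 \<and> lookup m VY = 0 \<and> lookup m VZ = 0 then p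
      else if lookup m VX = 0 \<and> lookup m VY = 2 \<and> lookup m VZ = 0 then q
      else if lookup m VX = 0 \<and> lookup m VY = 0 \<and> lookup m VZ = 2 then r
      else if lookup m VX = 1 \<and> lookup m VY = 1 \<and> lookup m VZ = 0 then u
      else if lookup m VX = 0 \<and> lookup m VY = 1 \<and> lookup m VZ = 1 then v
      else if lookup m VX = 1 \<and> lookup m VY = 0 \<and> lookup m VZ = 1 then w
      else 0)"
  unfolding quadratic_form_def
  by (auto simp: lookup_add lookup_single when_def var_monomial_eq_iff)

lemma quadratic_form_eq_iff:
  "quadratic_form p q r u v w = quadratic_form p' q' r' u' v' w' \<longleftrightarrow>
     p = p' \<and> q = q' \<and> r = r' \<and> u = u' \<and> v = v' \<and> w = w'" (is "?L \<longleftrightarrow> ?R")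
proof
  assume eq: ?L
  let ?s = "\<lambda>i j. Poly_Mapping.single i 1 + Poly_Mapping.single j 1 :: var \<Rightarrow>\<^sub>0 nat"
  have "lookup (quadratic_form p q r u v w) (?s i j) =
      lookup (quadratic_form p' q' r' u' v' w') (?s i j)" for i j
    by (simp add: eq)
  from this[of VX VX] this[of VY VY] this[of VZ VZ] this[of VX VY] this[of VY VZ] this[of VX VZ]
  show ?R
    by (simp add: lookup_quadratic_form lookup_add lookup_single)
qed auto

lemma keys_quadratic_form_mdeg:
  assumes "m \<in> keys (quadratic_form p q r u v w)"
  shows "mdeg m = 2"
  using assms by (auto simp: in_keys_iff lookup_quadratic_form mdeg_def split: if_splits)

section \<open>Factors of a quadratic form\<close>

text \<open>Used contrapositively: a non-constant factor has a term of positive degree. The zero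
  polynomial, with empty support, counts as constant.\<close>

lemma constant_poly_if_mdeg_0:
  assumes "\<And>k. k \<in> keys F \<Longrightarrow> mdeg k = 0"
  shows "constant_poly F"
proof -
  have "F = Const (lookup F 0)"
    unfolding Const_def
  proof (rule poly_mapping_eqI)
    fix k show "lookup F k = lookup (Poly_Mapping.single 0 (lookup F 0)) k"
      using assms[of k] by (auto simp: lookup_single when_def in_keys_iff mdeg_eq_0_iff)
  qed
  then show ?thesis
    unfolding constant_poly_def by blast
qed

lemma linear_form_if_mdeg_1:
  assumes "\<And>k. k \<in> keys F \<Longrightarrow> mdeg k = 1"
  obtains a b c where "F = linear_form a b c"
proof
  show "F = linear_form (lookup F (Poly_Mapping.single VX 1)) (lookup F (Poly_Mapping.single VY 1))
      (lookup F (Poly_Mapping.single VZ 1))" (is "F = ?L")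
  proof (rule poly_mapping_eqI)
    fix k
    let ?M = "{Poly_Mapping.single VX 1, Poly_Mapping.single VY 1, Poly_Mapping.single VZ 1}"
    show "lookup F k = lookup ?L k"
    proof (cases "k \<in> ?M")
      case True
      \<comment> \<open>The three unit exponents differ, so just one summand contributes at
        \<open>k\<close>. \<open>Suc 0\<close> is the form into which the simplifier brings
        \<open>1\<close>.\<close>
      moreover have "Poly_Mapping.single i (Suc 0) = Poly_Mapping.single j (Suc 0) \<longleftrightarrow> i = j"
        for i j :: var
        by (metis lookup_single_eq lookup_single_not_eq nat.distinct(1))
      ultimately show ?thesis
        by (auto simp: linear_form_def lookup_add lookup_single when_def)
    next
      case False
      with assms[of k] mdeg_eq_1D[of k] have "lookup F k = 0"
        by (auto simp: in_keys_iff)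
      with False show ?thesis
        by (auto simp: linear_form_def lookup_add lookup_single when_def)
    qed
  qed
qed

lemma not_constant_linear_form:
  assumes "a \<noteq> 0"
  shows "\<not> constant_poly (linear_form a b c)"
proof
  assume "constant_poly (linear_form a b c)"
  then obtain d where "linear_form a b c = Const d"
    unfolding constant_poly_def by blast
  then have "lookup (linear_form a b c) (Poly_Mapping.single VX 1) =
      lookup (Const d) (Poly_Mapping.single VX 1)"
    by simp
  with assms show False
    by (simp add: linear_form_def Const_def lookup_add lookup_single when_def var_monomial_eq_iff)
qed

lemma nonconstant_factors_of_quadratic_form:
  assumes prod: "quadratic_form p q r u v w = F * G"
    and F: "\<not> constant_poly F" and G: "\<not> constant_poly G"
  obtains a b c a' b' c' where "F = linear_form a b c" "G = linear_form a' b' c'"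
proof -
  have deg: "mdeg k + mdeg l = 2" if "k \<in> keys F" "l \<in> keys G" for k l
    using keys_quadratic_form_mdeg[of "k + l" p q r u v w] keys_trop_poly_mult[OF that]
    by (simp add: prod mdeg_add)
  obtain k where k: "k \<in> keys F" "mdeg k \<noteq> 0"
    using constant_poly_if_mdeg_0 F by blast
  obtain l where l: "l \<in> keys G" "mdeg l \<noteq> 0"
    using constant_poly_if_mdeg_0 G by blast
  \<comment> \<open>Two positive degrees with sum 2 are both 1. Pairing \<open>k\<close> and
    \<open>l\<close> with arbitrary terms of the other factor then forces degree 1
    throughout.\<close>
  from deg[OF k(1) l(1)] k(2) l(2) have "mdeg k = 1" "mdeg l = 1"
    by linarith+
  with deg k(1) l(1) have "\<And>i. i \<in> keys F \<Longrightarrow> mdeg i = 1" "\<And>j. j \<in> keys G \<Longrightarrow> mdeg j = 1"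
    by fastforce+
  with linear_form_if_mdeg_1 that show thesis
    by metis
qed

lemma reducible_monic_quadratic_form_iff:
  "trop_reducible (quadratic_form 1 1 1 u v w) \<longleftrightarrow>
     (\<exists>a b c. u = Fin \<bar>a - b\<bar> \<and> v = Fin \<bar>b - c\<bar> \<and> w = Fin \<bar>a - c\<bar>)" (is "?L \<longleftrightarrow> ?R")
proof
  assume ?L
  then obtain F G where FG: "quadratic_form 1 1 1 u v w = F * G"
      "\<not> constant_poly F" "\<not> constant_poly G"
    unfolding trop_reducible_def by blast
  then obtain a b c a' b' c' where "F = linear_form a b c" "G = linear_form a' b' c'"
    by (rule nonconstant_factors_of_quadratic_form)
  with FG(1) have eqs: "a * a' = 1" "b * b' = 1" "c * c' = 1"
      "u = a * b' + b * a'" "v = b * c' + c * b'" "w = a * c' + c * a'"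
    by (auto simp: linear_form_mult quadratic_form_eq_iff)
  obtain x where "a = Fin x" "a' = Fin (- x)" using eqs(1) by (rule trop_mult_eq_1E)
  moreover obtain y where "b = Fin y" "b' = Fin (- y)" using eqs(2) by (rule trop_mult_eq_1E)
  moreover obtain z where "c = Fin z" "c' = Fin (- z)" using eqs(3) by (rule trop_mult_eq_1E)
  ultimately show ?R
    using eqs(4-6) by (auto simp: Fin_add max_diff_eq_abs)
next
  assume ?R
  then obtain a b c where abc: "u = Fin \<bar>a - b\<bar>" "v = Fin \<bar>b - c\<bar>" "w = Fin \<bar>a - c\<bar>"
    by blast
  have "quadratic_form 1 1 1 u v w =
      linear_form (Fin a) (Fin b) (Fin c) * linear_form (Fin (- a)) (Fin (- b)) (Fin (- c))"
    by (simp add: linear_form_mult quadratic_form_eq_iff abc Fin_add max_diff_eq_abs one_trop_def)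
  \<comment> \<open>In both factors the coefficient of X is real, hence not \<open>0\<close>, so
    neither is constant.\<close>
  then show ?L
    unfolding trop_reducible_def using not_constant_linear_form
    by (metis trop.distinct(1) zero_trop_def)
qed

section \<open>Distances between three real points\<close>

text \<open>Of three points on a line one lies between the others, and the distance of the outer two
  is the sum of the remaining distances. The hypotheses exclude \<open>MInf\<close>.\<close>

lemma abs_differences_iff_max_eq_sum_of_others:
  assumes "Fin 0 \<le> u" "Fin 0 \<le> v" "Fin 0 \<le> w"
  shows "(\<exists>a b c. u = Fin \<bar>a - b\<bar> \<and> v = Fin \<bar>b - c\<bar> \<and> w = Fin \<bar>a - c\<bar>) \<longleftrightarrow>
     max_eq_sum_of_others u v w"
proof -
  obtain x y z where xyz: "u = Fin x" "v = Fin y" "w = Fin z"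
    using assms by (cases u; cases v; cases w) auto
  with assms have nonneg: "0 \<le> x" "0 \<le> y" "0 \<le> z"
    by auto
  have "(\<exists>a b c. x = \<bar>a - b\<bar> \<and> y = \<bar>b - c\<bar> \<and> z = \<bar>a - c\<bar>) \<longleftrightarrow>
      x = y + z \<or> y = x + z \<or> z = x + y" (is "?L \<longleftrightarrow> ?R")
  proof
    assume ?L
    then show ?R
      by (elim exE) linarith
  next
    assume ?R
    then consider "x = y + z" | "y = x + z" | "z = x + y"
      by blast
    then show ?L
    proof cases
      \<comment> \<open>The point \<open>c\<close> is placed at 0. It lies between \<open>a\<close>
        and \<open>b\<close> here, so these get opposite signs; in the other cases they lie on the
        same side.\<close>
      case 1
      with nonneg show ?thesis by (intro exI[of _ z] exI[of _ "- y"] exI[of _ 0]) auto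
    next
      case 2
      with nonneg show ?thesis by (intro exI[of _ z] exI[of _ y] exI[of _ 0]) auto
    next
      case 3
      with nonneg show ?thesis by (intro exI[of _ z] exI[of _ y] exI[of _ 0]) auto
    qed
  qed
  \<comment> \<open>A sum of nonnegative reals is at least each summand, which yields the
    maximality.\<close>
  also have "\<dots> \<longleftrightarrow> max_eq_sum_of_others u v w"
    using nonneg by (auto simp: max_eq_sum_of_others_def xyz max_def)
  finally show ?thesis
    by (simp add: xyz)
qed

theorem theorem3:
  fixes s21 s32 s31 :: trop and P :: trop_poly
  assumes "P = Var VX ^ 2 + Var VY ^ 2 + Var VZ ^ 2
             + Const s21 * Var VX * Var VY
             + Const s32 * Var VY * Var VZ
             + Const s31 * Var VX * Var VZ"
  shows "(s21 < Fin 0 \<or> s32 < Fin 0 \<or> s31 < Fin 0 \<longrightarrow> trop_irreducible P)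
       \<and> (s21 \<ge> Fin 0 \<and> s32 \<ge> Fin 0 \<and> s31 \<ge> Fin 0 \<longrightarrow>
            (trop_reducible P \<longleftrightarrow> max_eq_sum_of_others s21 s32 s31))"
proof -
  have "P = quadratic_form 1 1 1 s21 s32 s31"
    unfolding assms quadratic_form_def Var_def Const_def
    by (simp add: power2_eq_square mult_single)
  then have "trop_reducible P \<longleftrightarrow>
      (\<exists>a b c. s21 = Fin \<bar>a - b\<bar> \<and> s32 = Fin \<bar>b - c\<bar> \<and> s31 = Fin \<bar>a - c\<bar>)"
    by (simp add: reducible_monic_quadratic_form_iff)
  \<comment> \<open>An absolute value is neither negative nor \<open>MInf\<close>, whence the
    irreducibility in the first claim.\<close>
  then show ?thesis
    using abs_differences_iff_max_eq_sum_of_others[of s21 s32 s31]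
    by (auto simp: trop_irreducible_def not_le[symmetric])
qed

end
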